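(* Linear separability of complete data does not imply linear separability of incomplete data. That is, there exist integers $d,n\ge 1$, points $(X_i,Y_i)_{i=1,\dots,n}\in(\mathbb{R}^d\times\{-1,+1\})^n$ and missing patterns $(M_i)_{i=1,\dots,n}\in(\{0,1\}^d)^n$ such that the complete data $(X_i,Y_i)_{i=1,\dots,n}$ are linearly separable while the incomplete data $(X_i\odot(1-M_i),M_i,Y_i)_{i=1,\dots,n}$ are not linearly separable.
   Context: Here $\odot$ is the componentwise product, and $M_{i,j}=1$ means that the $j$-th coordinate of $X_i$ is missing. The complete data $(X_i,Y_i)_{i=1,\dots,n}\in(\mathbb{R}^d\times\{-1,+1\})^n$ are called linearly separable if there exists $(w^\star,b^\star)\in\mathbb{R}^d\times\mathbb{R}$ such that for all $i\in\{1,\dots,n\}$, $Y_i(X_i^\top w^\star+b^\star)>0$. The incomplete data $(X_i\odot(1-M_i),M_i,Y_i)_{i=1,\dots,n}$ are called linearly separable if for every $m\in\{0,1\}^d$ there exists $(w^\star_{(m)},b^\star_{(m)})\in\mathbb{R}^d\times\mathbb{R}$ such that for all $i$ with $M_i=m$, $Y_i\big((w^\star_{(m)})^\top((1-M_i)\odot X_i)+b^\star_{(m)}\big)>0$. *)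

theory Defs
  imports "Jordan_Normal_Form.Matrix"
begin

definition hadamard_prod :: "real vec \<Rightarrow> real vec \<Rightarrow> real vec" (infixl \<open>\<odot>\<close> 70) where
  "u \<odot> v = vec (dim_vec v) (\<lambda>j. u $ j * v $ j)"

definition ones_vec :: "nat \<Rightarrow> real vec" where
  "ones_vec d = vec d (\<lambda>_. 1)"

text \<open>The set of patterns \<open>{0,1}\<^sup>d\<close>; an entry 1 marks a missing coordinate.\<close>

definition missing_patterns :: "nat \<Rightarrow> real vec set" where
  "missing_patterns d = {m \<in> carrier_vec d. \<forall>j<d. m $ j \<in> {0, 1}}"

definition complete_linearly_separable ::
  "nat \<Rightarrow> nat \<Rightarrow> (nat \<Rightarrow> real vec) \<Rightarrow> (nat \<Rightarrow> real) \<Rightarrow> bool" where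
  "complete_linearly_separable d n X Y \<longleftrightarrow>
     (\<exists>w\<in>carrier_vec d. \<exists>b. \<forall>i\<in>{1..n}. Y i * (X i \<bullet> w + b) > 0)"

text \<open>The separating hyperplane may depend on the missing pattern. For a pattern \<open>m\<close> that no
  sample exhibits, the condition holds vacuously.\<close>

definition incomplete_linearly_separable ::
  "nat \<Rightarrow> nat \<Rightarrow> (nat \<Rightarrow> real vec) \<Rightarrow> (nat \<Rightarrow> real vec) \<Rightarrow> (nat \<Rightarrow> real) \<Rightarrow> bool" where
  "incomplete_linearly_separable d n X M Y \<longleftrightarrow>
     (\<forall>m\<in>missing_patterns d. \<exists>w\<in>carrier_vec d. \<exists>b. \<forall>i\<in>{1..n}. M i = m \<longrightarrow>
        Y i * (w \<bullet> ((ones_vec d - M i) \<odot> X i) + b) > 0)"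

end

theory Submission
  imports Defs
begin

text \<open>Masking can merge points that only the missing coordinates told apart. Each missing pattern
  gets its own affine function of the masked point, so two samples with the same pattern and the
  same masked point receive the same score. If their labels differ, no affine function has the
  right sign on both (\<open>not_separable_if_masked_collision\<close>).

  The smallest instance is on the real line: the points \<open>1\<close> and \<open>- 1\<close>, labelled by their own
  values, are separated by \<open>w = 1\<close>, \<open>b = 0\<close>. When the only coordinate is missing for both,
  both are masked to \<open>0\<close>.\<close>

lemma not_separable_if_masked_collision:
  assumes "i \<in> {1..n}" "j \<in> {1..n}"
    and pattern: "M i \<in> missing_patterns d" "M j = M i"
    and masked: "(ones_vec d - M j) \<odot> X j = (ones_vec d - M i) \<odot> X i"
    and labels: "Y j = - Y i"
  shows "\<not> incomplete_linearly_separable d n X M Y"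
proof
  assume "incomplete_linearly_separable d n X M Y"
  then obtain w b where sep:
    "\<forall>k\<in>{1..n}. M k = M i \<longrightarrow> Y k * (w \<bullet> ((ones_vec d - M k) \<odot> X k) + b) > 0"
    using pattern(1) unfolding incomplete_linearly_separable_def by blast
  define s where "s = w \<bullet> ((ones_vec d - M i) \<odot> X i) + b"
  have "Y i * s > 0"
    using sep assms(1) unfolding s_def by blast
  moreover have "Y j * s > 0"
    using sep assms(2) pattern(2) masked unfolding s_def by metis
  ultimately show False
    using labels by simp
qed

theorem lemma3p2:
  shows "\<exists>(d::nat) (n::nat) (X :: nat \<Rightarrow> real vec) (Y :: nat \<Rightarrow> real) (M :: nat \<Rightarrow> real vec).
    d \<ge> 1 \<and> n \<ge> 1 \<and>
    (\<forall>i\<in>{1..n}. X i \<in> carrier_vec d \<and> Y i \<in> {-1, 1} \<and> M i \<in> missing_patterns d) \<and>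
    complete_linearly_separable d n X Y \<and>
    \<not> incomplete_linearly_separable d n X M Y"
proof -
  define Y :: "nat \<Rightarrow> real" where "Y i = (if i = 1 then 1 else - 1)" for i
  define X :: "nat \<Rightarrow> real vec" where "X i = vec 1 (\<lambda>_. Y i)" for i
  define M :: "nat \<Rightarrow> real vec" where "M i = ones_vec 1" for i
  have valid: "X i \<in> carrier_vec 1 \<and> Y i \<in> {-1, 1} \<and> M i \<in> missing_patterns 1" for i
    by (simp add: X_def Y_def M_def ones_vec_def missing_patterns_def)
  \<comment> \<open>With \<open>w = 1\<close> and \<open>b = 0\<close> every margin is the square of a label.\<close>
  have "Y i * (X i \<bullet> ones_vec 1 + 0) > 0" for i
    by (simp add: X_def Y_def ones_vec_def scalar_prod_def)
  moreover have "ones_vec 1 \<in> carrier_vec 1"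
    by (simp add: ones_vec_def)
  ultimately have complete: "complete_linearly_separable 1 2 X Y"
    unfolding complete_linearly_separable_def by blast
  have "(ones_vec 1 - M 2) \<odot> X 2 = (ones_vec 1 - M 1) \<odot> X 1"
    by (rule eq_vecI) (simp_all add: hadamard_prod_def M_def X_def ones_vec_def)
  then have incomplete: "\<not> incomplete_linearly_separable 1 2 X M Y"
    using valid by (intro not_separable_if_masked_collision[where i = 1 and j = 2])
      (simp_all add: M_def Y_def)
  show ?thesis
    using valid complete incomplete
    by (intro exI[of _ 1] exI[of _ 2] exI[of _ X] exI[of _ Y] exI[of _ M]) simp
qed

end
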